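(* Let $X$ be a Tychonoff space without isolated points such that $Hom_p(X)$ is a topological group. Then for every subset $Y\subset X$, $Hom_p(XY')$ is a topological group (with composition as the group operation).
   Context: For a space $Z$, $Hom(Z)$ is the group, under composition, of all homeomorphisms of $Z$ onto itself, and $Hom_p(Z)$ is the set $Hom(Z)$ with the topology of point-wise convergence, whose basic open sets are $\{h\in Hom(Z): h(z_i)\in O_i,\ i=1,\dots,n\}$ with $z_1,\dots,z_n\in Z$ and $O_1,\dots,O_n$ open in $Z$. $XX'$ denotes the Alexandroff double of $X$: its underlying set is $X\cup X'$, where $X'=\{x':x\in X\}$ is a disjoint copy of $X$, and its topology is generated by the sets $(U\cup U')\setminus F'$ and $F'$, where $U$ is open in $X$, $U'=\{x':x\in U\}$, and $F'$ is a finite subset of $X'$. For $Y\subset X$, $XY'$ is the subspace $X\cup Y'$ of $XX'$, where $Y'=\{y':y\in Y\}$. *)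

theory Defs
  imports "HOL-Analysis.Analysis" "HOL-Algebra.Bij"
begin

definition tychonoff_space :: "'a topology \<Rightarrow> bool" where
  "tychonoff_space X \<longleftrightarrow> completely_regular_space X \<and> Hausdorff_space X"

definition no_isolated_points :: "'a topology \<Rightarrow> bool" where
  "no_isolated_points X \<longleftrightarrow> (\<forall>x\<in>topspace X. \<not> openin X {x})"

definition topological_group :: "('g, 'm) monoid_scheme \<Rightarrow> 'g topology \<Rightarrow> bool" where
  "topological_group G T \<longleftrightarrow>
     group G \<and> topspace T = carrier G \<and>
     continuous_map (prod_topology T T) T (\<lambda>(g, h). g \<otimes>\<^bsub>G\<^esub> h) \<and>
     continuous_map T T (\<lambda>g. inv\<^bsub>G\<^esub> g)"

text \<open>
  Membership in \<open>Bij (topspace Z)\<close> makes the functions extensional, so that a homeomorphism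
  is determined by its values on \<open>topspace Z\<close>. The product of \<open>BijGroup\<close> is composition
  and its unit is the identity, both restricted to \<open>topspace Z\<close>.
\<close>

definition homeos :: "'a topology \<Rightarrow> ('a \<Rightarrow> 'a) set" where
  "homeos Z = {h \<in> Bij (topspace Z). homeomorphic_map Z Z h}"

definition homeo_group :: "'a topology \<Rightarrow> ('a \<Rightarrow> 'a) monoid" where
  "homeo_group Z = BijGroup (topspace Z) \<lparr>carrier := homeos Z\<rparr>"

text \<open>
  The generating sets are closed under finite intersections and (by \<open>n = 0\<close>) include all of
  \<open>homeos Z\<close>, so they form a base of the topology.
\<close>

definition homeos_pointwise :: "'a topology \<Rightarrow> ('a \<Rightarrow> 'a) topology" where
  "homeos_pointwise Z = topology_generated_by
     {{h \<in> homeos Z. \<forall>i<n. h (z i) \<in> W i} |(n::nat) z W.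
        \<forall>i<n. z i \<in> topspace Z \<and> openin Z (W i)}"

text \<open>The point \<open>x\<close> of \<open>X\<close> is \<open>Inl x\<close>, its copy \<open>x'\<close> is \<open>Inr x\<close>.\<close>

definition alexandroff_double :: "'a topology \<Rightarrow> ('a + 'a) topology" where
  "alexandroff_double X = topology_generated_by
     ({(Inl ` U \<union> Inr ` U) - Inr ` F |U F. openin X U \<and> finite F \<and> F \<subseteq> topspace X} \<union>
      {Inr ` F |F. finite F \<and> F \<subseteq> topspace X})"

definition partial_alexandroff_double :: "'a topology \<Rightarrow> 'a set \<Rightarrow> ('a + 'a) topology" where
  "partial_alexandroff_double X Y =
     subtopology (alexandroff_double X) (Inl ` topspace X \<union> Inr ` Y)"

end

theory Submission
  imports Defs
begin

text \<open>
  The isolated points of \<open>XY'\<close> are exactly the points of \<open>Y'\<close>, so every homeomorphism of \<open>XY'\<close>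
  preserves both \<open>X\<close> and \<open>Y'\<close> and restricts to a homeomorphism of \<open>X\<close>; this restriction is
  continuous for the pointwise topologies. A map into the pointwise topology is continuous iff all
  its evaluations are. Evaluations at points of \<open>X\<close> factor through the restriction, where
  the hypothesis on \<open>X\<close> applies; evaluations of products and inverses at points of \<open>Y'\<close> are locally
  determined by finitely many values because these points are isolated.
\<close>

section \<open>The group of homeomorphisms of a space\<close>

lemma homeos_D:
  assumes "h \<in> homeos Z"
  shows "h \<in> Bij (topspace Z)" "homeomorphic_map Z Z h" "h \<in> extensional (topspace Z)"
    "bij_betw h (topspace Z) (topspace Z)"
  using assms by (auto simp: homeos_def Bij_def)

lemma homeos_in_topspace: "h \<in> homeos Z \<Longrightarrow> z \<in> topspace Z \<Longrightarrow> h z \<in> topspace Z"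
  by (rule bij_betwE[OF homeos_D(4), rule_format])

lemma homeos_one: "(\<lambda>x\<in>topspace Z. x) \<in> homeos Z"
  unfolding homeos_def
  by (auto simp: id_Bij intro: homeomorphic_map_eq[OF homeomorphic_map_id[THEN iffD2, OF refl]])

lemma homeos_mult:
  assumes "g \<in> homeos Z" "h \<in> homeos Z"
  shows "compose (topspace Z) g h \<in> homeos Z"
proof -
  have "homeomorphic_map Z Z (g \<circ> h)"
    using assms homeos_D(2) homeomorphic_map_compose by blast
  then have "homeomorphic_map Z Z (compose (topspace Z) g h)"
    by (rule homeomorphic_map_eq) (simp add: compose_def)
  then show ?thesis
    using assms by (simp add: homeos_def compose_Bij)
qed

text \<open>The inverse \<open>k\<close> supplied by \<open>homeomorphic_maps\<close> may be
  arbitrary off \<open>topspace Z\<close>. On \<open>topspace Z\<close> injectivity of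
  \<open>h\<close> forces it to agree with \<open>inv_into\<close>, and that agreement carries the
  homeomorphism property over to the extensional version.\<close>

lemma homeos_inv:
  assumes "h \<in> homeos Z"
  shows "(\<lambda>x\<in>topspace Z. inv_into (topspace Z) h x) \<in> homeos Z"
proof -
  obtain k where k: "homeomorphic_maps Z Z h k"
    using homeos_D(2)[OF assms] homeomorphic_map_maps by blast
  have eq: "k x = inv_into (topspace Z) h x" if "x \<in> topspace Z" for x
  proof -
    have "k x \<in> topspace Z" "h (k x) = x"
      using k that by (auto simp: homeomorphic_maps_def continuous_map_def)
    then show ?thesis
      using homeos_D(4)[OF assms] by (metis bij_betw_def inv_into_f_f)
  qed
  have "homeomorphic_map Z Z k"
    using k homeomorphic_maps_map by blast
  then have "homeomorphic_map Z Z (\<lambda>x\<in>topspace Z. inv_into (topspace Z) h x)"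
    by (rule homeomorphic_map_eq) (simp add: eq)
  then show ?thesis
    using homeos_D(1)[OF assms] by (simp add: homeos_def restrict_inv_into_Bij)
qed

text \<open>The group laws come from the group of all bijections, so only closure has to be
  checked.\<close>

lemma subgroup_homeos: "subgroup (homeos Z) (BijGroup (topspace Z))"
proof (rule group.subgroupI[OF group_BijGroup])
  show "homeos Z \<subseteq> carrier (BijGroup (topspace Z))"
    by (auto simp: BijGroup_def homeos_def)
  show "homeos Z \<noteq> {}"
    using homeos_one by blast
  show "inv\<^bsub>BijGroup (topspace Z)\<^esub> h \<in> homeos Z" if "h \<in> homeos Z" for h
    using that by (simp add: inv_BijGroup homeos_D homeos_inv)
  show "g \<otimes>\<^bsub>BijGroup (topspace Z)\<^esub> h \<in> homeos Z" if "g \<in> homeos Z" "h \<in> homeos Z" for g h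
    using that by (simp add: BijGroup_def homeos_D homeos_mult)
qed

lemma group_homeo_group: "group (homeo_group Z)"
  unfolding homeo_group_def
  by (rule subgroup.subgroup_is_group[OF subgroup_homeos group_BijGroup])

lemma carrier_homeo_group: "carrier (homeo_group Z) = homeos Z"
  by (simp add: homeo_group_def)

lemma mult_homeo_group:
  "g \<in> homeos Z \<Longrightarrow> h \<in> homeos Z \<Longrightarrow> g \<otimes>\<^bsub>homeo_group Z\<^esub> h = compose (topspace Z) g h"
  by (simp add: homeo_group_def BijGroup_def homeos_D)

lemma inv_homeo_group:
  "h \<in> homeos Z \<Longrightarrow> inv\<^bsub>homeo_group Z\<^esub> h = (\<lambda>x\<in>topspace Z. inv_into (topspace Z) h x)"
  unfolding homeo_group_def
  by (simp add: group.m_inv_consistent[OF group_BijGroup subgroup_homeos] inv_BijGroup homeos_D)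

section \<open>Pointwise convergence and evaluations\<close>

lemma topspace_homeos_pointwise [simp]: "topspace (homeos_pointwise Z) = homeos Z"
proof -
  have "homeos Z \<in> {{h \<in> homeos Z. \<forall>i<n. h (z i) \<in> W i} |(n::nat) z W.
        \<forall>i<n. z i \<in> topspace Z \<and> openin Z (W i)}"
    by (auto intro!: exI[of _ 0])
  then show ?thesis
    unfolding homeos_pointwise_def topology_generated_by_topspace by auto
qed

lemma continuous_map_homeos_eval:
  assumes "z \<in> topspace Z"
  shows "continuous_map (homeos_pointwise Z) Z (\<lambda>h. h z)"
  unfolding continuous_map_def
proof (intro conjI allI impI)
  show "(\<lambda>h. h z) \<in> topspace (homeos_pointwise Z) \<rightarrow> topspace Z"
    using assms homeos_in_topspace by auto
  show "openin (homeos_pointwise Z) {h \<in> topspace (homeos_pointwise Z). h z \<in> U}"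
    if "openin Z U" for U
    unfolding topspace_homeos_pointwise unfolding homeos_pointwise_def
    \<comment> \<open>The preimage is itself a generating set: one condition, with constant families
      \<open>z\<close> and \<open>U\<close>.\<close>
    by (rule topology_generated_by_Basis, rule CollectI,
        rule exI[of _ 1], rule exI[of _ "\<lambda>_. z"], rule exI[of _ "\<lambda>_. U"]) (use that assms in auto)
qed

text \<open>A generating set imposes finitely many conditions, so its preimage is a finite
  intersection of preimages under evaluations. With the continuity of evaluations this is the
  universal property of an initial topology.\<close>

lemma continuous_map_into_homeos_pointwise:
  assumes hom: "\<And>t. t \<in> topspace T \<Longrightarrow> f t \<in> homeos Z"
    and eval: "\<And>z. z \<in> topspace Z \<Longrightarrow> continuous_map T Z (\<lambda>t. f t z)"
  shows "continuous_map T (homeos_pointwise Z) f"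
  unfolding homeos_pointwise_def
proof (rule continuous_on_generated_topo)
  fix B assume "B \<in> {{h \<in> homeos Z. \<forall>i<n. h (z i) \<in> W i} |(n::nat) z W.
        \<forall>i<n. z i \<in> topspace Z \<and> openin Z (W i)}"
  then obtain n :: nat and z W where B: "B = {h \<in> homeos Z. \<forall>i<n. h (z i) \<in> W i}"
    and zW: "\<And>i. i < n \<Longrightarrow> z i \<in> topspace Z \<and> openin Z (W i)" by blast
  \<comment> \<open>The factor \<open>topspace T\<close> matters for \<open>n = 0\<close>, where the
    intersection over the empty family is \<open>UNIV\<close>.\<close>
  have eq: "f -` B \<inter> topspace T = topspace T \<inter> \<Inter>((\<lambda>i. {t \<in> topspace T. f t (z i) \<in> W i}) ` {..<n})"
    using hom by (auto simp: B)
  have "openin T {t \<in> topspace T. f t (z i) \<in> W i}" if "i < n" for i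
    using eval zW[OF that] openin_continuous_map_preimage by fast
  then show "openin T (f -` B \<inter> topspace T)"
    unfolding eq by (cases "n = 0") (auto intro!: openin_Int openin_INT2)
next
  show "f ` topspace T \<subseteq> \<Union> {{h \<in> homeos Z. \<forall>i<n. h (z i) \<in> W i} |(n::nat) z W.
        \<forall>i<n. z i \<in> topspace Z \<and> openin Z (W i)}"
    using hom topspace_homeos_pointwise[of Z]
    unfolding homeos_pointwise_def topology_generated_by_topspace by auto
qed

text \<open>The group axioms always hold, and continuity into the pointwise topology is tested by
  evaluations. The criterion serves in both directions: to extract information from \<open>X\<close>
  and to conclude for the subspace of the double.\<close>

lemma topological_group_homeo_group_iff:
  "topological_group (homeo_group Z) (homeos_pointwise Z) \<longleftrightarrow>
    (\<forall>z\<in>topspace Z.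
      continuous_map (prod_topology (homeos_pointwise Z) (homeos_pointwise Z)) Z (\<lambda>p. fst p (snd p z)) \<and>
      continuous_map (homeos_pointwise Z) Z (\<lambda>h. inv_into (topspace Z) h z))"
  (is "?G \<longleftrightarrow> ?E")
proof
  let ?T = "homeos_pointwise Z"
  assume G: ?G
  show ?E
  proof (intro ballI conjI)
    fix z assume z: "z \<in> topspace Z"
    have "continuous_map (prod_topology ?T ?T) Z ((\<lambda>h. h z) \<circ> (\<lambda>(g, h). g \<otimes>\<^bsub>homeo_group Z\<^esub> h))"
      using G continuous_map_homeos_eval[OF z] unfolding topological_group_def
      by (blast intro: continuous_map_compose)
    then show "continuous_map (prod_topology ?T ?T) Z (\<lambda>p. fst p (snd p z))"
      by (rule continuous_map_eq) (auto simp: mult_homeo_group compose_def z)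
    have "continuous_map ?T Z ((\<lambda>h. h z) \<circ> (\<lambda>g. inv\<^bsub>homeo_group Z\<^esub> g))"
      using G continuous_map_homeos_eval[OF z] unfolding topological_group_def
      by (blast intro: continuous_map_compose)
    then show "continuous_map ?T Z (\<lambda>h. inv_into (topspace Z) h z)"
      by (rule continuous_map_eq) (auto simp: inv_homeo_group z)
  qed
next
  let ?T = "homeos_pointwise Z"
  assume E: ?E
  show ?G
    unfolding topological_group_def
  proof (intro conjI)
    show "group (homeo_group Z)" by (rule group_homeo_group)
    show "topspace ?T = carrier (homeo_group Z)" by (simp add: carrier_homeo_group)
    show "continuous_map (prod_topology ?T ?T) ?T (\<lambda>(g, h). g \<otimes>\<^bsub>homeo_group Z\<^esub> h)"
    proof (rule continuous_map_into_homeos_pointwise)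
      fix z assume z: "z \<in> topspace Z"
      then have "continuous_map (prod_topology ?T ?T) Z (\<lambda>p. fst p (snd p z))"
        using E by blast
      then show "continuous_map (prod_topology ?T ?T) Z (\<lambda>p. (case p of (g, h) \<Rightarrow> g \<otimes>\<^bsub>homeo_group Z\<^esub> h) z)"
        by (rule continuous_map_eq) (auto simp: mult_homeo_group compose_def z)
    qed (auto simp: mult_homeo_group homeos_mult)
    show "continuous_map ?T ?T (\<lambda>g. inv\<^bsub>homeo_group Z\<^esub> g)"
    proof (rule continuous_map_into_homeos_pointwise)
      fix z assume z: "z \<in> topspace Z"
      then have "continuous_map ?T Z (\<lambda>h. inv_into (topspace Z) h z)"
        using E by blast
      then show "continuous_map ?T Z (\<lambda>h. (inv\<^bsub>homeo_group Z\<^esub> h) z)"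
        by (rule continuous_map_eq) (auto simp: inv_homeo_group z)
    qed (auto simp: inv_homeo_group homeos_inv)
  qed
qed

section \<open>The Alexandroff double and its subspaces\<close>

lemma topspace_alexandroff_double:
  "topspace (alexandroff_double X) = Inl ` topspace X \<union> Inr ` topspace X"
proof
  show "topspace (alexandroff_double X) \<subseteq> Inl ` topspace X \<union> Inr ` topspace X"
    unfolding alexandroff_double_def topology_generated_by_topspace
    by (auto dest!: openin_subset)
  \<comment> \<open>A single generator, with \<open>U\<close> the whole space and \<open>F\<close>
    empty, covers all points.\<close>
  have "(Inl ` topspace X \<union> Inr ` topspace X) - Inr ` {} \<in>
     ({(Inl ` U \<union> Inr ` U) - Inr ` F |U F. openin X U \<and> finite F \<and> F \<subseteq> topspace X} \<union>
      {Inr ` F |F. finite F \<and> F \<subseteq> topspace X})"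
    by blast
  then show "Inl ` topspace X \<union> Inr ` topspace X \<subseteq> topspace (alexandroff_double X)"
    unfolding alexandroff_double_def topology_generated_by_topspace by auto
qed

locale partial_double =
  fixes X :: "'a topology" and Y :: "'a set" and Z :: "('a + 'a) topology"
  assumes no_iso: "no_isolated_points X" and Y: "Y \<subseteq> topspace X"
  defines "Z \<equiv> partial_alexandroff_double X Y"
begin

lemma topspace_Z: "topspace Z = Inl ` topspace X \<union> Inr ` Y"
  using Y by (auto simp: Z_def partial_alexandroff_double_def topspace_alexandroff_double)

lemma openin_Z_Inr:
  assumes "y \<in> Y"
  shows "openin Z {Inr y}"
proof -
  have "openin (alexandroff_double X) (Inr ` {y})"
    unfolding alexandroff_double_def
    by (rule topology_generated_by_Basis, rule UnI2, rule CollectI, rule exI[of _ "{y}"])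
      (use assms Y in auto)
  moreover have "{Inr y} = Inr ` {y} \<inter> (Inl ` topspace X \<union> Inr ` Y)"
    using assms by auto
  ultimately show ?thesis
    unfolding Z_def partial_alexandroff_double_def openin_subtopology by blast
qed

text \<open>\<open>case_sum id id\<close> forgets the prime. The preimage of \<open>U\<close> is the
  trace on \<open>Z\<close> of the generator for \<open>U\<close> and empty
  \<open>F\<close>.\<close>

lemma continuous_map_fold: "continuous_map Z X (case_sum id id)"
  unfolding continuous_map_def
proof (intro conjI allI impI)
  show "case_sum id id \<in> topspace Z \<rightarrow> topspace X"
    using Y by (auto simp: topspace_Z)
  fix U assume U: "openin X U"
  have "openin (alexandroff_double X) (Inl ` U \<union> Inr ` U - Inr ` {})"
    unfolding alexandroff_double_def
    by (rule topology_generated_by_Basis, rule UnI1, rule CollectI, rule exI[of _ U], rule exI[of _ "{}"])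
      (use U in simp)
  moreover have "{z \<in> topspace Z. case_sum id id z \<in> U} =
      (Inl ` U \<union> Inr ` U - Inr ` {}) \<inter> (Inl ` topspace X \<union> Inr ` Y)"
    by (auto simp: topspace_Z)
  ultimately show "openin Z {z \<in> topspace Z. case_sum id id z \<in> U}"
    unfolding Z_def partial_alexandroff_double_def openin_subtopology by blast
qed

text \<open>Pulling a generator back along \<open>Inl\<close> discards the primed points, which
  leaves \<open>U\<close> or the empty set. As the fold is a left inverse of \<open>Inl\<close>,
  this makes \<open>X\<close> a retract of \<open>Z\<close>.\<close>

lemma continuous_map_Inl: "continuous_map X Z Inl"
  unfolding Z_def partial_alexandroff_double_def
proof (rule continuous_map_into_subtopology)
  show "continuous_map X (alexandroff_double X) Inl"
    unfolding alexandroff_double_def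
  proof (rule continuous_on_generated_topo)
    fix B :: "('a + 'a) set"
    assume "B \<in> {(Inl ` U \<union> Inr ` U) - Inr ` F |U F. openin X U \<and> finite F \<and> F \<subseteq> topspace X} \<union>
      {Inr ` F |F. finite F \<and> F \<subseteq> topspace X}"
    then consider U F where "openin X U" "B = (Inl ` U \<union> Inr ` U) - Inr ` F" | F where "B = Inr ` F"
      by blast
    then show "openin X (Inl -` B \<inter> topspace X)"
    proof cases
      case 1
      then have "Inl -` B \<inter> topspace X = U"
        by (auto dest: openin_subset)
      then show ?thesis using 1 by simp
    next
      case 2
      then have "Inl -` B \<inter> topspace X = {}" by auto
      then show ?thesis by simp
    qed
  next
    show "Inl ` topspace X \<subseteq> \<Union> ({(Inl ` U \<union> Inr ` U) - Inr ` F |U F. openin X U \<and> finite F \<and> F \<subseteq> topspace X} \<union>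
      {Inr ` F |F. finite F \<and> F \<subseteq> topspace X})"
      using topspace_alexandroff_double[of X]
      unfolding alexandroff_double_def topology_generated_by_topspace by auto
  qed
qed auto

section \<open>Isolated points and the restriction of a homeomorphism to X\<close>

text \<open>An isolated point \<open>Inl x\<close> would pull back along \<open>Inl\<close> to an
  isolated point \<open>x\<close> of \<open>X\<close>; this is where the absence of such points
  enters.\<close>

lemma isolated_iff:
  assumes "z \<in> topspace Z"
  shows "openin Z {z} \<longleftrightarrow> z \<in> Inr ` Y"
proof
  assume z: "openin Z {z}"
  show "z \<in> Inr ` Y"
  proof (rule ccontr)
    assume "z \<notin> Inr ` Y"
    then obtain x where x: "x \<in> topspace X" "z = Inl x"
      using assms by (auto simp: topspace_Z)
    have "openin X {a \<in> topspace X. Inl a \<in> {z}}"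
      by (rule openin_continuous_map_preimage[OF continuous_map_Inl z])
    moreover have "{a \<in> topspace X. Inl a \<in> {z}} = {x}"
      using x by auto
    ultimately show False
      using no_iso x by (simp add: no_isolated_points_def)
  qed
qed (auto intro: openin_Z_Inr)

text \<open>Homeomorphisms preserve and reflect isolation, which characterizes the primed
  points.\<close>

lemma homeo_mem_Inr_iff:
  assumes "h \<in> homeos Z" "z \<in> topspace Z"
  shows "h z \<in> Inr ` Y \<longleftrightarrow> z \<in> Inr ` Y"
proof -
  have "openin Z (h ` {z}) \<longleftrightarrow> openin Z {z}"
    using homeomorphic_map_openness[OF homeos_D(2)[OF assms(1)], of "{z}"] assms(2) by simp
  then show ?thesis
    using assms by (simp add: isolated_iff homeos_in_topspace)
qed

text \<open>The fold strips the tag from \<open>h (Inl x)\<close>, which keeps the map total and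
  makes its continuity a matter of composition. For \<open>h\<close> in \<open>homeos Z\<close> the
  value \<open>h (Inl x)\<close> is unprimed, so this is the genuine restriction to
  \<open>X\<close>.\<close>

definition base_restriction :: "('a + 'a \<Rightarrow> 'a + 'a) \<Rightarrow> 'a \<Rightarrow> 'a" where
  "base_restriction h = (\<lambda>x\<in>topspace X. case_sum id id (h (Inl x)))"

lemma homeo_Inl:
  assumes "h \<in> homeos Z" "x \<in> topspace X"
  shows "h (Inl x) = Inl (base_restriction h x)"
proof -
  have "Inl x \<in> topspace Z" using assms by (simp add: topspace_Z)
  then have "h (Inl x) \<in> topspace Z" "h (Inl x) \<notin> Inr ` Y"
    using homeos_in_topspace[OF assms(1)] homeo_mem_Inr_iff[OF assms(1)] by auto
  then show ?thesis
    using assms(2) by (auto simp: topspace_Z base_restriction_def)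
qed

lemma continuous_base_restriction:
  assumes "h \<in> homeos Z"
  shows "continuous_map X X (base_restriction h)"
proof -
  have "continuous_map Z Z h"
    using homeos_D(2)[OF assms] homeomorphic_imp_continuous_map by blast
  then have "continuous_map X X (case_sum id id \<circ> (h \<circ> Inl))"
    by (rule continuous_map_compose[OF continuous_map_compose[OF continuous_map_Inl] continuous_map_fold])
  then show ?thesis
    by (rule continuous_map_eq) (simp add: base_restriction_def)
qed

text \<open>\<open>Inl\<close> is injective and intertwines each homeomorphism with its restriction.
  Only a one-sided inverse is assumed, so the lemma applies to \<open>h\<close> and its inverse in
  either order.\<close>

lemma base_restriction_inverse:
  assumes "g \<in> homeos Z" "h \<in> homeos Z" "\<And>z. z \<in> topspace Z \<Longrightarrow> g (h z) = z" "x \<in> topspace X"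
  shows "base_restriction g (base_restriction h x) = x"
proof -
  have "base_restriction h x \<in> topspace X"
    using continuous_base_restriction[OF assms(2)] assms(4)
    by (meson continuous_map_image_subset_topspace image_subset_iff)
  then have "Inl (base_restriction g (base_restriction h x)) = g (h (Inl x))"
    using assms by (simp add: homeo_Inl)
  also have "\<dots> = Inl x"
    using assms by (simp add: topspace_Z)
  finally show ?thesis by (simp)
qed

lemma homeos_inv_cancel:
  assumes "h \<in> homeos Z" "z \<in> topspace Z"
  shows "(\<lambda>z\<in>topspace Z. inv_into (topspace Z) h z) (h z) = z"
    "h ((\<lambda>z\<in>topspace Z. inv_into (topspace Z) h z) z) = z"
  using assms homeos_in_topspace[OF assms] homeos_D(4)[OF assms(1)]
  by (auto simp: bij_betw_inv_into_left bij_betw_inv_into_right)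

text \<open>Restricting the inverse homeomorphism as well yields bijectivity and continuity of the
  inverse at once.\<close>

lemma base_restriction_maps:
  assumes "h \<in> homeos Z"
  defines "k \<equiv> (\<lambda>z\<in>topspace Z. inv_into (topspace Z) h z)"
  shows "homeomorphic_maps X X (base_restriction h) (base_restriction k)"
proof -
  have "k \<in> homeos Z" unfolding k_def by (rule homeos_inv[OF assms(1)])
  then show ?thesis
    unfolding homeomorphic_maps_def
    using assms(1) homeos_inv_cancel[OF assms(1)]
    by (auto intro!: continuous_base_restriction base_restriction_inverse simp: k_def)
qed

lemma base_restriction_homeos:
  assumes "h \<in> homeos Z"
  shows "base_restriction h \<in> homeos X"
proof -
  have "homeomorphic_map X X (base_restriction h)"
    using base_restriction_maps[OF assms] homeomorphic_maps_map by blast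
  moreover from this have "bij_betw (base_restriction h) (topspace X) (topspace X)"
    by (simp add: homeomorphic_eq_everything_map bij_betw_def)
  ultimately show ?thesis
    \<comment> \<open>The second call settles extensionality, which is built into
      \<open>base_restriction\<close>.\<close>
    by (simp add: homeos_def Bij_def) (simp add: base_restriction_def)
qed

text \<open>The preimage taken in \<open>X\<close> gives a preimage of \<open>Inl x\<close> in
  \<open>Z\<close>, and injectivity of \<open>h\<close> makes it the only one. This reduces
  inversion at points of \<open>X\<close> to inversion in \<open>homeos X\<close>.\<close>

lemma inv_into_Inl:
  assumes "h \<in> homeos Z" "x \<in> topspace X"
  shows "inv_into (topspace Z) h (Inl x) = Inl (inv_into (topspace X) (base_restriction h) x)"
proof (rule inv_into_f_eq)
  let ?y = "inv_into (topspace X) (base_restriction h) x"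
  note bij = homeos_D(4)[OF base_restriction_homeos[OF assms(1)]]
  show "inj_on h (topspace Z)"
    using homeos_D(4)[OF assms(1)] by (rule bij_betw_imp_inj_on)
  have y: "?y \<in> topspace X"
    using bij assms(2) by (metis bij_betw_def inv_into_into)
  then show "Inl ?y \<in> topspace Z"
    by (simp add: topspace_Z)
  show "h (Inl ?y) = Inl x"
    using homeo_Inl[OF assms(1) y] bij_betw_inv_into_right[OF bij assms(2)] by simp
qed

text \<open>Evaluating the restriction at \<open>x\<close> is evaluating at \<open>Inl x\<close> and
  then folding.\<close>

lemma continuous_map_base_restriction:
  "continuous_map (homeos_pointwise Z) (homeos_pointwise X) base_restriction"
proof (rule continuous_map_into_homeos_pointwise)
  fix x assume x: "x \<in> topspace X"
  then have "continuous_map (homeos_pointwise Z) Z (\<lambda>h. h (Inl x))"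
    by (intro continuous_map_homeos_eval) (simp add: topspace_Z)
  then have "continuous_map (homeos_pointwise Z) X (case_sum id id \<circ> (\<lambda>h. h (Inl x)))"
    by (rule continuous_map_compose[OF _ continuous_map_fold])
  then show "continuous_map (homeos_pointwise Z) X (\<lambda>h. base_restriction h x)"
    by (rule continuous_map_eq) (simp add: base_restriction_def x)
qed (simp add: base_restriction_homeos)

lemma openin_eval_vimage:
  assumes "z \<in> topspace Z" "openin Z W"
  shows "openin (homeos_pointwise Z) {h \<in> homeos Z. h z \<in> W}"
  using openin_continuous_map_preimage[OF continuous_map_homeos_eval[OF assms(1)] assms(2)] by simp

section \<open>Products and inverses at the isolated points\<close>

text \<open>Split by the value \<open>Inr w\<close> of the inner map at \<open>Inr y\<close>. Since
  \<open>{Inr w}\<close> is open, prescribing that value is an open condition, and what remains is a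
  condition on the outer map at the fixed point \<open>Inr w\<close>.\<close>

lemma continuous_mult_Inr:
  assumes "y \<in> Y"
  shows "continuous_map (prod_topology (homeos_pointwise Z) (homeos_pointwise Z)) Z
    (\<lambda>p. fst p (snd p (Inr y)))"
  unfolding continuous_map_def
proof (intro conjI allI impI)
  let ?T = "homeos_pointwise Z"
  have y: "Inr y \<in> topspace Z" using assms by (simp add: topspace_Z)
  show "(\<lambda>p. fst p (snd p (Inr y))) \<in> topspace (prod_topology ?T ?T) \<rightarrow> topspace Z"
    by (rule Pi_I) (use homeos_in_topspace[OF _ homeos_in_topspace[OF _ y]] in auto)
  fix W assume W: "openin Z W"
  have "{p \<in> topspace (prod_topology ?T ?T). fst p (snd p (Inr y)) \<in> W} =
    (\<Union>w\<in>Y. {g \<in> homeos Z. g (Inr w) \<in> W} \<times> {h \<in> homeos Z. h (Inr y) \<in> {Inr w}})"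
    (is "?L = ?R")
  proof
    show "?L \<subseteq> ?R"
    proof
      fix p assume p: "p \<in> ?L"
      \<comment> \<open>The inner map sends the isolated point to an isolated point, so the pieces
        indexed by \<open>Y\<close> cover every pair.\<close>
      then have "snd p (Inr y) \<in> Inr ` Y"
        using homeo_mem_Inr_iff[OF _ y] assms by auto
      with p show "p \<in> ?R" by force
    qed
    show "?R \<subseteq> ?L" by auto
  qed
  moreover have "openin (prod_topology ?T ?T)
      ({g \<in> homeos Z. g (Inr w) \<in> W} \<times> {h \<in> homeos Z. h (Inr y) \<in> {Inr w}})" if "w \<in> Y" for w
    unfolding openin_prod_Times_iff
    using openin_eval_vimage[OF _ W] openin_eval_vimage[OF y openin_Z_Inr] that by (simp add: topspace_Z)
  ultimately show "openin (prod_topology ?T ?T) {p \<in> topspace (prod_topology ?T ?T). fst p (snd p (Inr y)) \<in> W}"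
    by auto
qed

text \<open>Openness of \<open>{Inr y}\<close> makes \<open>h (Inr w) = Inr y\<close> an open
  condition on \<open>h\<close> for each fixed \<open>w\<close>; the preimage of \<open>W\<close> is
  a union of such conditions.\<close>

lemma continuous_inv_Inr:
  assumes "y \<in> Y"
  shows "continuous_map (homeos_pointwise Z) Z (\<lambda>h. inv_into (topspace Z) h (Inr y))"
  unfolding continuous_map_def
proof (intro conjI allI impI)
  let ?T = "homeos_pointwise Z"
  have y: "Inr y \<in> topspace Z" using assms by (simp add: topspace_Z)
  have inv: "inv_into (topspace Z) h (Inr y) \<in> topspace Z \<and> h (inv_into (topspace Z) h (Inr y)) = Inr y"
    if "h \<in> homeos Z" for h
    using homeos_D(4)[OF that] y by (metis bij_betw_def f_inv_into_f inv_into_into)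
  then show "(\<lambda>h. inv_into (topspace Z) h (Inr y)) \<in> topspace ?T \<rightarrow> topspace Z"
    by auto
  fix W assume W: "openin Z W"
  \<comment> \<open>Only primed points of \<open>W\<close> are candidates, because the preimage of
    an isolated point is isolated.\<close>
  have "inv_into (topspace Z) h (Inr y) \<in> W \<longleftrightarrow> (\<exists>w\<in>Y \<inter> Inr -` W. h (Inr w) \<in> {Inr y})"
    if h: "h \<in> homeos Z" for h
  proof
    assume "inv_into (topspace Z) h (Inr y) \<in> W"
    moreover have "inv_into (topspace Z) h (Inr y) \<in> Inr ` Y"
      using homeo_mem_Inr_iff[OF h] inv[OF h] assms by auto
    ultimately show "\<exists>w\<in>Y \<inter> Inr -` W. h (Inr w) \<in> {Inr y}"
      using inv[OF h] by auto
  next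
    assume "\<exists>w\<in>Y \<inter> Inr -` W. h (Inr w) \<in> {Inr y}"
    then obtain w where w: "w \<in> Y" "Inr w \<in> W" "h (Inr w) = Inr y" by auto
    have "inv_into (topspace Z) h (Inr y) = Inr w"
      using homeos_D(4)[OF h] w by (intro inv_into_f_eq) (auto simp: bij_betw_def topspace_Z)
    then show "inv_into (topspace Z) h (Inr y) \<in> W" using w by simp
  qed
  then have "{h \<in> topspace ?T. inv_into (topspace Z) h (Inr y) \<in> W} =
    (\<Union>w\<in>Y \<inter> Inr -` W. {h \<in> homeos Z. h (Inr w) \<in> {Inr y}})"
    by auto
  moreover have "openin ?T {h \<in> homeos Z. h (Inr w) \<in> {Inr y}}" if "w \<in> Y" for w
    using that by (intro openin_eval_vimage openin_Z_Inr assms) (simp add: topspace_Z)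
  ultimately show "openin ?T {h \<in> topspace ?T. inv_into (topspace Z) h (Inr y) \<in> W}"
    by auto
qed

lemma topological_group_partial_double:
  assumes "topological_group (homeo_group X) (homeos_pointwise X)"
  shows "topological_group (homeo_group Z) (homeos_pointwise Z)"
  unfolding topological_group_homeo_group_iff
proof (intro ballI)
  let ?T = "homeos_pointwise Z" and ?S = "homeos_pointwise X"
  let ?r = base_restriction
  fix z assume "z \<in> topspace Z"
  then consider x where "x \<in> topspace X" "z = Inl x" | y where "y \<in> Y" "z = Inr y"
    by (auto simp: topspace_Z)
  then show "continuous_map (prod_topology ?T ?T) Z (\<lambda>p. fst p (snd p z)) \<and>
      continuous_map ?T Z (\<lambda>h. inv_into (topspace Z) h z)"
  proof cases
    case 1
    \<comment> \<open>The criterion read on \<open>X\<close> gives continuity at \<open>x\<close> of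
      products and of inverses.\<close>
    note X = assms[unfolded topological_group_homeo_group_iff, rule_format, OF 1(1)]
    have "continuous_map (prod_topology ?T ?T) (prod_topology ?S ?S) (\<lambda>p. (?r (fst p), ?r (snd p)))"
      by (intro continuous_map_pairedI
          continuous_map_compose[OF continuous_map_fst continuous_map_base_restriction, unfolded o_def]
          continuous_map_compose[OF continuous_map_snd continuous_map_base_restriction, unfolded o_def])
    \<comment> \<open>Evaluation of a product at \<open>Inl x\<close> factors: restrict both maps,
      evaluate their product at \<open>x\<close>, embed by \<open>Inl\<close>. Inversion below
      factors in the same way.\<close>
    then have "continuous_map (prod_topology ?T ?T) Z
        (Inl \<circ> ((\<lambda>p. fst p (snd p x)) \<circ> (\<lambda>p. (?r (fst p), ?r (snd p)))))"
      by (rule continuous_map_compose[OF continuous_map_compose[OF _ conjunct1[OF X]] continuous_map_Inl])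
    then have "continuous_map (prod_topology ?T ?T) Z (\<lambda>p. fst p (snd p z))"
      by (rule continuous_map_eq)
        (use 1 homeos_in_topspace[OF base_restriction_homeos] in \<open>auto simp: homeo_Inl\<close>)
    moreover have "continuous_map ?T Z (Inl \<circ> ((\<lambda>h. inv_into (topspace X) h x) \<circ> ?r))"
      by (rule continuous_map_compose[OF continuous_map_compose[OF continuous_map_base_restriction
              conjunct2[OF X]] continuous_map_Inl])
    then have "continuous_map ?T Z (\<lambda>h. inv_into (topspace Z) h z)"
      by (rule continuous_map_eq) (use 1 in \<open>auto simp: inv_into_Inl\<close>)
    ultimately show ?thesis by blast
  next
    case 2
    then show ?thesis
      by (simp add: continuous_mult_Inr continuous_inv_Inr)
  qed
qed

end

theorem theorem3p5:
  fixes X :: "'a topology"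
  assumes "tychonoff_space X"
    and "no_isolated_points X"
    and "topological_group (homeo_group X) (homeos_pointwise X)"
  shows "\<forall>Y \<subseteq> topspace X.
    topological_group (homeo_group (partial_alexandroff_double X Y))
      (homeos_pointwise (partial_alexandroff_double X Y))"
proof (intro allI impI)
  fix Y assume "Y \<subseteq> topspace X"
  then have "partial_double X Y"
    using assms(2) by (simp add: partial_double_def)
  then show "topological_group (homeo_group (partial_alexandroff_double X Y))
      (homeos_pointwise (partial_alexandroff_double X Y))"
    using assms(3) by (rule partial_double.topological_group_partial_double)
qed

end
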